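(* The number tree is connected: for every number $x$, there exists a unique path $(x_\gamma)_{\gamma<\lambda}$ such that $x_0=0_{\mathrm{Co}}$ and $x=\lim_{\gamma\to\lambda}x_\gamma$. Explicitly, this path is given by the family of truncations of $x$, with $\lambda=\mathrm{b}(x)$ if $x$ is a limit number, and $\lambda=\mathrm{b}(x)+1$ if $x$ is a successor number: $$\forall\gamma<\lambda:\qquad x_\gamma=[x]_\gamma=\{\delta\in x\mid\delta<\gamma\}\cup\{\gamma\}.$$
   Context: A number is a set $x$ of (von Neumann) ordinals having a maximal element, denoted $\mathrm{b}(x)$ and called its birthday; $0_{\mathrm{Co}}=\{0\}$. A number $x$ is a successor number if $\mathrm{b}(x)$ is a successor ordinal, and a limit number if $\mathrm{b}(x)$ is a limit ordinal (an ordinal without maximal element; $0$ is counted as a limit ordinal). The relation $x\preceq y$ between numbers means: $\mathrm{b}(x)\le\mathrm{b}(y)$ and for all $\alpha<\mathrm{b}(x)$, $\alpha\in x\Leftrightarrow\alpha\in y$; it is a partial order, and $x\prec y$ means $x\preceq y$ and $x\ne y$. The number tree is the Hasse diagram of $\preceq$. The two children of a number $x$ are $x_+:=x\cup\{\mathrm{b}(x)+1\}$ and $x_-:=(x\cup\{\mathrm{b}(x)+1\})\setminus\{\mathrm{b}(x)\}$. For an ordinal $\gamma$, the truncation is $[x]_\gamma:=x$ if $\mathrm{b}(x)\le\gamma$, and $[x]_\gamma:=\{\delta\in x\mid\delta<\gamma\}\cup\{\gamma\}$ if $\mathrm{b}(x)>\gamma$. A chain is an ordinal-indexed family of numbers $(x_\gamma)_{\gamma<\lambda}$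 with $x_\gamma\preceq x_\beta$ for all $\gamma<\beta<\lambda$; its limit $\lim_{\gamma\to\lambda}x_\gamma$ is the unique number $x$ with $x_\gamma\preceq x$ for all $\gamma<\lambda$ and $x\preceq x'$ for every number $x'$ with this property. A path (maximal chain) is a chain $(x_\gamma)_{\gamma<\lambda}$ admitting no proper refinement: if $\gamma<\beta<\lambda$ and a number $z$ satisfies $x_\gamma\prec z\prec x_\beta$, then there exists $\delta$ with $\gamma<\delta<\beta$ and $z=x_\delta$; in particular, $x_{\gamma+1}$ is a child of $x_\gamma$, that is, $x_{\gamma+1}=(x_\gamma)_+$ or $(x_\gamma)_-$.
   Formalization: For a limit number x, appending x as a last term gives a second path with limit x, so uniqueness is asserted among paths whose length λ is a limit ordinal when x is a limit number; for x=0_Co the path is empty, and x_0=0_Co is required only if λ>0. *)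

theory Defs
  imports Main "HOL-Library.FuncSet"
begin

text \<open>
  HOL has no type of all ordinals.  The ordinals are represented by the elements of an arbitrary
  well-ordered type \<open>'a\<close> without a greatest element, i.e. by the ordinals below an arbitrary limit
  ordinal \<open>\<kappa> > 0\<close>; an element \<open>a\<close> stands for the order type of \<open>{..<a}\<close>.  A number
  is then a subset of \<open>'a\<close> with a maximal element.  The absence of a greatest element
  makes ordinal successors total.
\<close>

definition ord_zero :: "'a::wellorder" where
  "ord_zero = (LEAST a. True)"

definition ord_succ :: "'a::{wellorder,no_top} \<Rightarrow> 'a" where
  "ord_succ a = (LEAST b. a < b)"

definition succ_ordinal :: "'a::{wellorder,no_top} \<Rightarrow> bool" where
  "succ_ordinal a \<longleftrightarrow> (\<exists>b. a = ord_succ b)"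

text \<open>The predecessors of \<open>a\<close> have no maximum; in particular zero is a limit ordinal.\<close>

definition limit_ordinal :: "'a::wellorder \<Rightarrow> bool" where
  "limit_ordinal a \<longleftrightarrow> \<not> (\<exists>m<a. \<forall>b<a. b \<le> m)"

definition is_number :: "'a::wellorder set \<Rightarrow> bool" where
  "is_number x \<longleftrightarrow> (\<exists>m\<in>x. \<forall>a\<in>x. a \<le> m)"

definition birthday :: "'a::wellorder set \<Rightarrow> 'a" where
  "birthday x = (GREATEST m. m \<in> x)"

definition zero_Co :: "'a::wellorder set" where
  "zero_Co = {ord_zero}"

definition successor_number :: "'a::{wellorder,no_top} set \<Rightarrow> bool" where
  "successor_number x \<longleftrightarrow> is_number x \<and> succ_ordinal (birthday x)"

definition limit_number :: "'a::wellorder set \<Rightarrow> bool" where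
  "limit_number x \<longleftrightarrow> is_number x \<and> limit_ordinal (birthday x)"

definition num_le :: "'a::wellorder set \<Rightarrow> 'a set \<Rightarrow> bool" (infix "\<preceq>" 50) where
  "x \<preceq> y \<longleftrightarrow> is_number x \<and> is_number y \<and> birthday x \<le> birthday y \<and>
     (\<forall>a<birthday x. a \<in> x \<longleftrightarrow> a \<in> y)"

definition num_less :: "'a::wellorder set \<Rightarrow> 'a set \<Rightarrow> bool" (infix "\<prec>" 50) where
  "x \<prec> y \<longleftrightarrow> x \<preceq> y \<and> x \<noteq> y"

definition child_plus :: "'a::{wellorder,no_top} set \<Rightarrow> 'a set" where
  "child_plus x = x \<union> {ord_succ (birthday x)}"

definition child_minus :: "'a::{wellorder,no_top} set \<Rightarrow> 'a set" where
  "child_minus x = (x \<union> {ord_succ (birthday x)}) - {birthday x}"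

definition truncation :: "'a::wellorder set \<Rightarrow> 'a \<Rightarrow> 'a set" where
  "truncation x c = (if birthday x \<le> c then x else {d \<in> x. d < c} \<union> {c})"

text \<open>
  A family indexed by the ordinals below \<open>l\<close> is a function made canonical (\<open>undefined\<close>)
  outside \<open>{..<l}\<close>, so that equality of families is equality of functions.
\<close>

definition is_chain :: "'a::wellorder \<Rightarrow> ('a \<Rightarrow> 'a set) \<Rightarrow> bool" where
  "is_chain l f \<longleftrightarrow> f \<in> {..<l} \<rightarrow>\<^sub>E {x. is_number x} \<and>
     (\<forall>c b. c < b \<and> b < l \<longrightarrow> f c \<preceq> f b)"

text \<open>
  The limit is a relation because a chain that is unbounded in \<open>'a\<close> has none; by antisymmetry of
  \<open>\<preceq>\<close> there is at most one.
\<close>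

definition is_chain_limit :: "'a::wellorder \<Rightarrow> ('a \<Rightarrow> 'a set) \<Rightarrow> 'a set \<Rightarrow> bool" where
  "is_chain_limit l f x \<longleftrightarrow> is_number x \<and> (\<forall>c<l. f c \<preceq> x) \<and>
     (\<forall>x'. is_number x' \<and> (\<forall>c<l. f c \<preceq> x') \<longrightarrow> x \<preceq> x')"

text \<open>
  The refinement condition alone does not exclude repetitions, because chains are only weakly
  increasing.  The condition on children excludes them.
\<close>

definition is_path :: "'a::{wellorder,no_top} \<Rightarrow> ('a \<Rightarrow> 'a set) \<Rightarrow> bool" where
  "is_path l f \<longleftrightarrow> is_chain l f \<and>
     (\<forall>c b z. c < b \<and> b < l \<and> is_number z \<and> f c \<prec> z \<and> z \<prec> f b \<longrightarrow>
        (\<exists>d. c < d \<and> d < b \<and> z = f d)) \<and>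
     (\<forall>c. ord_succ c < l \<longrightarrow> f (ord_succ c) = child_plus (f c) \<or> f (ord_succ c) = child_minus (f c))"

text \<open>
  The condition on the initial term is guarded because the path to \<open>zero_Co\<close>, a limit number, has
  length \<open>birthday zero_Co = ord_zero\<close> and is empty; its limit is the least number, \<open>zero_Co\<close>.
\<close>

definition path_from_zero :: "'a::{wellorder,no_top} \<Rightarrow> ('a \<Rightarrow> 'a set) \<Rightarrow> 'a set \<Rightarrow> bool" where
  "path_from_zero l f x \<longleftrightarrow> is_path l f \<and> (ord_zero < l \<longrightarrow> f ord_zero = zero_Co) \<and>
     is_chain_limit l f x"

text \<open>
  If \<open>x\<close> is a limit number, the path of length \<open>birthday x\<close> can be prolonged by \<open>x\<close> itself
  without changing its limit.  The path to \<open>x\<close> is the one without this last term: its length is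
  required to be a limit ordinal when \<open>x\<close> is a limit number.
\<close>

definition proper_path_from_zero :: "'a::{wellorder,no_top} \<Rightarrow> ('a \<Rightarrow> 'a set) \<Rightarrow> 'a set \<Rightarrow> bool" where
  "proper_path_from_zero l f x \<longleftrightarrow> path_from_zero l f x \<and> (limit_number x \<longrightarrow> limit_ordinal l)"

end

theory Submission
  imports Defs
begin

text \<open>
  A number is determined by its birthday together with its membership pattern below the birthday,
  and \<open>\<preceq>\<close> compares these patterns as initial segments.  Hence the numbers \<open>z \<preceq> x\<close> are
  exactly the truncations of \<open>x\<close>, one for every birthday up to \<open>birthday x\<close>
  (\<open>truncation_num_le\<close>, \<open>birthday_truncation\<close>, \<open>num_le_eq_truncation\<close>): below
  \<open>x\<close> the tree is a copy of the well-order \<open>{..birthday x}\<close>.  This makes the family of truncations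
  a path to \<open>x\<close>.

  Conversely, the terms of a path to \<open>x\<close> lie below \<open>x\<close>, so they are truncations of \<open>x\<close>, and only
  their birthdays remain to be found.  A path from zero can neither skip a birthday, by the
  refinement condition, nor repeat one, by the condition on children; so its \<open>c\<close>-th term has birthday
  \<open>c\<close> (\<open>birthday_path\<close>) and is the \<open>c\<close>-th truncation.  What is left is the length \<open>l\<close>.  It is at
  most the successor of \<open>birthday x\<close>.  If it is smaller, then \<open>truncation x l\<close> bounds the path, so the
  leastness of the limit \<open>x\<close> forces \<open>l = birthday x\<close>.  Such a path has limit \<open>x\<close> only if it has
  no last term, that is, if \<open>x\<close> is a limit number.
\<close>

section \<open>Successor and limit ordinals\<close>

lemma ord_zero_le: "ord_zero \<le> a"
  unfolding ord_zero_def by (rule Least_le) simp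

lemma less_ord_succ: "a < ord_succ a"
  unfolding ord_succ_def by (rule LeastI_ex) (rule gt_ex)

lemma ord_succ_le_iff: "ord_succ a \<le> b \<longleftrightarrow> a < b"
  using less_ord_succ[of a] by (auto simp: ord_succ_def intro: Least_le)

lemma less_ord_succ_iff: "b < ord_succ a \<longleftrightarrow> b \<le> a"
  by (metis ord_succ_le_iff linorder_not_le)

lemma limit_ordinal_iff_not_succ_ordinal: "limit_ordinal a \<longleftrightarrow> \<not> succ_ordinal a"
proof -
  have "a = ord_succ m \<longleftrightarrow> m < a \<and> (\<forall>b<a. b \<le> m)" for m
    by (metis less_ord_succ less_ord_succ_iff ord_succ_le_iff order_antisym linorder_not_le)
  then show ?thesis
    unfolding limit_ordinal_def succ_ordinal_def by blast
qed

section \<open>Birthdays, truncations and the order of the tree\<close>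

lemma birthday_eqI:
  assumes "m \<in> x" and "\<And>a. a \<in> x \<Longrightarrow> a \<le> m"
  shows "birthday x = m"
  unfolding birthday_def by (rule Greatest_equality) (use assms in auto)

lemma birthday_in: "is_number x \<Longrightarrow> birthday x \<in> x"
  unfolding is_number_def using birthday_eqI by blast

lemma le_birthday: "is_number x \<Longrightarrow> a \<in> x \<Longrightarrow> a \<le> birthday x"
  unfolding is_number_def using birthday_eqI by blast

lemma number_eqI:
  assumes "is_number x" "is_number y" "birthday x = birthday y"
    and "\<And>a. a < birthday x \<Longrightarrow> a \<in> x \<longleftrightarrow> a \<in> y"
  shows "x = y"
  using assms by (metis birthday_in le_birthday order_le_less subsetI subset_antisym)

lemma birthday_zero_Co: "birthday zero_Co = ord_zero"
  by (rule birthday_eqI) (auto simp: zero_Co_def)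

lemma birthday_child_plus:
  assumes "is_number x"
  shows "birthday (child_plus x) = ord_succ (birthday x)"
  using le_birthday[OF assms] less_ord_succ[of "birthday x"]
  by (intro birthday_eqI)
    (auto simp: child_plus_def intro: order.strict_implies_order order_le_less_trans)

lemma birthday_child_minus:
  assumes "is_number x"
  shows "birthday (child_minus x) = ord_succ (birthday x)"
  using le_birthday[OF assms] less_ord_succ[of "birthday x"]
  by (intro birthday_eqI)
    (auto simp: child_minus_def intro: order.strict_implies_order order_le_less_trans)

lemma truncation_eq:
  assumes "is_number x" "c \<le> birthday x"
  shows "truncation x c = {d \<in> x. d < c} \<union> {c}"
  using assms birthday_in[OF assms(1)] le_birthday[OF assms(1)]
  unfolding truncation_def by (auto simp: order_le_less)

lemma truncation_birthday: "truncation x (birthday x) = x"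
  by (simp add: truncation_def)

lemma
  assumes "is_number x" "c \<le> birthday x"
  shows is_number_truncation: "is_number (truncation x c)"
    and birthday_truncation: "birthday (truncation x c) = c"
  unfolding truncation_eq[OF assms] by (auto simp: is_number_def intro!: birthday_eqI)

lemma mem_truncation_iff:
  assumes "is_number x" "c \<le> birthday x" "a < c"
  shows "a \<in> truncation x c \<longleftrightarrow> a \<in> x"
  using assms(3) by (auto simp: truncation_eq[OF assms(1,2)])

lemma num_le_trans:
  assumes "x \<preceq> y" "y \<preceq> z"
  shows "x \<preceq> z"
  using assms unfolding num_le_def by (auto dest: order_less_le_trans)

lemma truncation_num_le:
  assumes "is_number x" "c \<le> birthday x"
  shows "truncation x c \<preceq> x"
  using assms
  by (simp add: num_le_def is_number_truncation birthday_truncation mem_truncation_iff)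

lemma truncation_mono:
  assumes "is_number x" "c \<le> b" "b \<le> birthday x"
  shows "truncation x c \<preceq> truncation x b"
  using assms
  by (auto simp: num_le_def is_number_truncation birthday_truncation mem_truncation_iff)

lemma num_le_eq_truncation:
  assumes "z \<preceq> x"
  shows "z = truncation x (birthday z)"
  using assms
  by (intro number_eqI)
     (auto simp: num_le_def is_number_truncation birthday_truncation mem_truncation_iff)

text \<open>
  A number has only one truncation of a given birthday, so \<open>y \<preceq> z\<close> with equal birthdays means
  \<open>y = z\<close>.
\<close>

lemma num_less_birthday_less:
  assumes "y \<prec> z"
  shows "birthday y < birthday z"
proof -
  have "y \<preceq> z" "y \<noteq> z" using assms by (auto simp: num_less_def)
  then show ?thesis
    using num_le_eq_truncation[of y z] truncation_birthday[of z]
    by (metis num_le_def order_le_less)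
qed

section \<open>Truncations form a path\<close>

text \<open>
  Passing from one truncation to the next records one bit: whether the old birthday belongs to
  \<open>x\<close>.  This bit decides which child is taken.
\<close>

lemma truncation_ord_succ:
  assumes "is_number x" "ord_succ c \<le> birthday x"
  shows "truncation x (ord_succ c) =
    (if c \<in> x then child_plus (truncation x c) else child_minus (truncation x c))"
proof -
  have c: "c \<le> birthday x"
    using assms(2) by (simp add: ord_succ_le_iff)
  have "truncation x (ord_succ c) = {d \<in> x. d < c} \<union> ({c} \<inter> x) \<union> {ord_succ c}"
    using truncation_eq[OF assms] by (auto simp: less_ord_succ_iff order_le_less)
  then show ?thesis
    using less_ord_succ[of c] truncation_eq[OF assms(1) c]
    unfolding child_plus_def child_minus_def birthday_truncation[OF assms(1) c] by auto
qed

lemma is_path_truncation: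
  assumes x: "is_number x" and l: "l \<le> ord_succ (birthday x)"
  shows "is_path l (restrict (truncation x) {..<l})"
proof -
  have below: "c \<le> birthday x" if "c < l" for c
    using that l by (metis less_ord_succ_iff order_less_le_trans)
  have chain: "is_chain l (restrict (truncation x) {..<l})"
    unfolding is_chain_def
    using x below by (auto intro: is_number_truncation truncation_mono)
  have refine: "\<exists>d. c < d \<and> d < b \<and> z = restrict (truncation x) {..<l} d"
    if cb: "c < b" "b < l"
      and z: "restrict (truncation x) {..<l} c \<prec> z" "z \<prec> restrict (truncation x) {..<l} b"
    for c b z
  proof -
    have c: "c < l" using cb by simp
    have z': "truncation x c \<prec> z" "z \<prec> truncation x b"
      using z c cb by auto
    have "c < birthday z" "birthday z < b"
      using z'[THEN num_less_birthday_less] birthday_truncation[OF x] below c cb by auto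
    moreover have "z \<preceq> x"
      using z'(2) truncation_num_le[OF x below[OF cb(2)]]
      by (auto simp: num_less_def intro: num_le_trans)
    then have "z = truncation x (birthday z)"
      by (rule num_le_eq_truncation)
    ultimately show ?thesis
      using cb(2) by (metis lessThan_iff order_less_trans restrict_apply')
  qed
  have children: "restrict (truncation x) {..<l} (ord_succ c)
        = child_plus (restrict (truncation x) {..<l} c)
      \<or> restrict (truncation x) {..<l} (ord_succ c)
        = child_minus (restrict (truncation x) {..<l} c)"
    if "ord_succ c < l" for c
  proof -
    have "c < l" using that less_ord_succ order_less_trans by blast
    then show ?thesis
      using truncation_ord_succ[OF x below[OF that]] that by auto
  qed
  show ?thesis
    unfolding is_path_def by (intro conjI allI impI chain) (use refine children in blast)+
qed

text \<open>
  Unless the family ends with \<open>x\<close> itself, every upper bound must be shown to agree with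
  \<open>x\<close> below \<open>birthday x\<close>.  This holds because each ordinal below a limit ordinal is exceeded by
  another one, so membership of each \<open>a < birthday x\<close> is already settled by some truncation.
\<close>

lemma is_chain_limit_truncation:
  assumes x: "is_number x"
    and l: "limit_number x \<and> l = birthday x \<or> l = ord_succ (birthday x)"
  shows "is_chain_limit l (restrict (truncation x) {..<l}) x"
proof -
  have below: "c \<le> birthday x" if "c < l" for c
    using that l by (auto simp: less_ord_succ_iff)
  have least: "x \<preceq> y"
    if y: "is_number y" and bound: "\<And>c. c < l \<Longrightarrow> truncation x c \<preceq> y" for y
    using l
  proof
    assume "l = ord_succ (birthday x)"
    then show ?thesis
      using bound[of "birthday x"] by (simp add: less_ord_succ truncation_birthday)
  next
    assume lim: "limit_number x \<and> l = birthday x"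
    have larger: "\<exists>c>a. c < l" if "a < l" for a
      using lim that unfolding limit_number_def limit_ordinal_def by (meson linorder_not_le)
    have le: "c \<le> birthday y" if "c < l" for c
      using bound[OF that] birthday_truncation[OF x below[OF that]] by (simp add: num_le_def)
    have "birthday x \<le> birthday y"
      using le larger lim by (metis linorder_not_le)
    moreover have "a \<in> x \<longleftrightarrow> a \<in> y" if a: "a < birthday x" for a
    proof -
      obtain c where c: "a < c" "c < l"
        using larger[of a] a lim by auto
      have "a \<in> truncation x c \<longleftrightarrow> a \<in> y"
        using bound[OF c(2)] c(1) birthday_truncation[OF x below[OF c(2)]]
        by (simp add: num_le_def)
      then show ?thesis
        using mem_truncation_iff[OF x below[OF c(2)] c(1)] by simp
    qed
    ultimately show ?thesis
      using x y by (simp add: num_le_def)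
  qed
  show ?thesis
    unfolding is_chain_limit_def
    using x below least by (auto intro: truncation_num_le)
qed

lemma path_from_zero_truncation:
  assumes x: "is_number x"
    and l: "limit_number x \<and> l = birthday x \<or> l = ord_succ (birthday x)"
  shows "path_from_zero l (restrict (truncation x) {..<l}) x"
proof -
  have "l \<le> ord_succ (birthday x)"
    using l less_ord_succ[of "birthday x"] by auto
  moreover have "truncation x ord_zero = zero_Co"
    using truncation_eq[OF x ord_zero_le] ord_zero_le
    by (auto simp: zero_Co_def dest: order_less_le_trans)
  ultimately show ?thesis
    unfolding path_from_zero_def
    using is_path_truncation[OF x] is_chain_limit_truncation[OF x l] by simp
qed

section \<open>Every path from zero consists of truncations\<close>

text \<open>
  Suppose that the birthdays of all earlier terms are their indices.  If \<open>f c\<close> were born after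
  \<open>c\<close>, its truncation at \<open>c\<close> would lie strictly between \<open>f ord_zero\<close> and \<open>f c\<close>, hence be an earlier
  term, though its birthday \<open>c\<close> is too late for that.  If \<open>f c\<close> were born at some \<open>d < c\<close>,
  then \<open>c\<close> would have to be the successor of \<open>d\<close>, since otherwise \<open>f (ord_succ d)\<close>, born after \<open>d\<close>,
  would lie below \<open>f c\<close>; but then \<open>f c\<close> is a child of \<open>f d\<close>, hence born at \<open>c\<close>.
\<close>

lemma birthday_path:
  assumes path: "is_path l f" and zero: "ord_zero < l \<Longrightarrow> f ord_zero = zero_Co"
    and "c < l"
  shows "birthday (f c) = c"
  using \<open>c < l\<close>
proof (induction c rule: less_induct)
  case (less c)
  have IH: "birthday (f d) = d" if "d < c" for d
    using less that by simp
  have num: "is_number (f d)" if "d < l" for d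
    using path that by (auto simp: is_path_def is_chain_def)
  have mono: "f d \<preceq> f c" if "d < c" for d
    using path that less.prems by (auto simp: is_path_def is_chain_def)
  show ?case
  proof (cases "c = ord_zero")
    case True
    then show ?thesis
      using zero less.prems birthday_zero_Co by simp
  next
    case False
    then have pos: "ord_zero < c"
      using ord_zero_le[of c] by simp
    have "\<not> c < birthday (f c)"
    proof
      assume late: "c < birthday (f c)"
      let ?z = "truncation (f c) c"
      have fc: "is_number (f c)" using num less.prems .
      have z: "is_number ?z" "birthday ?z = c"
        using fc late by (auto intro: is_number_truncation birthday_truncation)
      have "?z \<prec> f c"
        using truncation_num_le[OF fc] late z(2)
        by (metis num_less_def order_less_imp_le order_less_irrefl)
      moreover have "f ord_zero \<prec> ?z"
      proof -
        have "f ord_zero = truncation (f c) ord_zero"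
          using num_le_eq_truncation[OF mono[OF pos]] unfolding IH[OF pos] .
        then have "f ord_zero \<preceq> ?z"
          using truncation_mono[OF fc ord_zero_le, of c] late by simp
        then show ?thesis
          using IH[OF pos] z(2) pos by (metis num_less_def order_less_irrefl)
      qed
      ultimately obtain d where "d < c" "?z = f d"
        using path pos less.prems z(1) unfolding is_path_def by (metis (no_types))
      then show False
        using IH z(2) by (metis order_less_irrefl)
    qed
    moreover have "\<not> birthday (f c) < c"
    proof
      assume early: "birthday (f c) < c"
      define d where "d = birthday (f c)"
      then have d: "d < c" using early by simp
      have "\<not> ord_succ d < c"
      proof
        assume "ord_succ d < c"
        then have "ord_succ d \<le> d"
          unfolding d_def using mono IH by (metis num_le_def)
        then show False
          by (simp add: ord_succ_le_iff)
      qed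
      then have c: "c = ord_succ d"
        using d by (metis ord_succ_le_iff order_le_less)
      have "f c = child_plus (f d) \<or> f c = child_minus (f d)"
        using path less.prems c unfolding is_path_def by (metis (no_types))
      moreover have "is_number (f d)"
        using num d less.prems by simp
      ultimately have "d = ord_succ d"
        unfolding d_def
        using birthday_child_plus birthday_child_minus IH[OF d, unfolded d_def] by metis
      then show False
        using less_ord_succ[of d] by (metis order_less_irrefl)
    qed
    ultimately show ?thesis by simp
  qed
qed

lemma path_from_zero_imp_truncation:
  assumes x: "is_number x" and path: "path_from_zero l f x"
  shows "limit_number x \<and> l = birthday x \<or> l = ord_succ (birthday x)"
    and "f = restrict (truncation x) {..<l}"
proof -
  have bound: "f c \<preceq> x" if "c < l" for c
    using path that by (simp add: path_from_zero_def is_chain_limit_def)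
  have least: "x \<preceq> y" if "is_number y" "\<And>c. c < l \<Longrightarrow> f c \<preceq> y" for y
    using path that by (simp add: path_from_zero_def is_chain_limit_def)
  have birth: "birthday (f c) = c" if "c < l" for c
    using path that by (intro birthday_path) (auto simp: path_from_zero_def)
  have below: "c \<le> birthday x" if "c < l" for c
    using bound[OF that] birth[OF that] by (simp add: num_le_def)
  have f: "f c = truncation x c" if "c < l" for c
    using num_le_eq_truncation[OF bound[OF that]] birth[OF that] by metis
  have "f \<in> extensional {..<l}"
    using path by (auto simp: path_from_zero_def is_path_def is_chain_def PiE_def)
  then show "f = restrict (truncation x) {..<l}"
    using f by (intro extensionalityI[where A = "{..<l}"]) auto
  show "limit_number x \<and> l = birthday x \<or> l = ord_succ (birthday x)"
  proof (cases "birthday x < l")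
    case True
    have "l \<le> ord_succ (birthday x)"
      using below less_ord_succ[of "birthday x"] by (metis linorder_not_le)
    then show ?thesis
      using True by (metis ord_succ_le_iff order_antisym)
  next
    case False
    then have l: "l \<le> birthday x" by simp
    have "f c \<preceq> truncation x l" if "c < l" for c
      using f[OF that] truncation_mono[OF x _ l, of c] that by simp
    then have "x \<preceq> truncation x l"
      by (intro least is_number_truncation[OF x l])
    then have "birthday x = l"
      using l birthday_truncation[OF x l] by (simp add: num_le_def)
    moreover have "limit_ordinal (birthday x)"
      unfolding limit_ordinal_def
    proof
      assume "\<exists>m<birthday x. \<forall>b<birthday x. b \<le> m"
      then obtain m where m: "m < l" "\<And>b. b < l \<Longrightarrow> b \<le> m"
        using \<open>birthday x = l\<close> by blast
      \<comment> \<open>The last term of the path is an upper bound that is born before \<open>x\<close>.\<close>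
      have "f c \<preceq> f m" if "c < l" for c
        using f m that truncation_mono[OF x m(2)[OF that] below[OF m(1)]] by simp
      moreover have "is_number (f m)"
        using bound[OF m(1)] by (simp add: num_le_def)
      ultimately have "x \<preceq> f m"
        by (intro least)
      then show False
        using birth[OF m(1)] m(1) \<open>birthday x = l\<close> by (auto simp: num_le_def)
    qed
    ultimately show ?thesis
      using x by (simp add: limit_number_def)
  qed
qed

section \<open>Connectedness of the number tree\<close>

theorem theorem2p45:
  fixes x :: "'a::{wellorder,no_top} set"
  assumes "is_number x"
  shows "(\<exists>!(l, f). proper_path_from_zero l f x)
    \<and> (\<forall>l f. proper_path_from_zero l f x \<longrightarrow>
          (limit_number x \<longrightarrow> l = birthday x) \<and>
          (successor_number x \<longrightarrow> l = ord_succ (birthday x)) \<and>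
          (\<forall>c<l. f c = truncation x c \<and> truncation x c = {d \<in> x. d < c} \<union> {c}))
    \<and> (\<forall>l f. path_from_zero l f x \<longleftrightarrow>
          (limit_number x \<and> l = birthday x \<or> l = ord_succ (birthday x)) \<and>
          f = restrict (truncation x) {..<l})"
proof -
  have paths: "path_from_zero l f x \<longleftrightarrow>
      (limit_number x \<and> l = birthday x \<or> l = ord_succ (birthday x)) \<and>
      f = restrict (truncation x) {..<l}" for l f
    using path_from_zero_imp_truncation[OF assms, of l f] path_from_zero_truncation[OF assms, of l]
    by metis
  have succ: "\<not> limit_ordinal (ord_succ (birthday x))"
    by (auto simp: limit_ordinal_iff_not_succ_ordinal succ_ordinal_def)
  let ?l = "if limit_number x then birthday x else ord_succ (birthday x)"
  \<comment> \<open>Of the two lengths that lead to a limit number, only the shorter one is a limit ordinal.\<close>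
  have proper: "proper_path_from_zero l f x \<longleftrightarrow> l = ?l \<and> f = restrict (truncation x) {..<l}"
    for l f
    unfolding proper_path_from_zero_def paths using succ by (auto simp: limit_number_def)
  have unique: "\<exists>!(l, f). proper_path_from_zero l f x"
    unfolding proper by (rule ex1I[of _ "(?l, restrict (truncation x) {..<?l})"]) auto
  have exclusive: "\<not> (limit_number x \<and> successor_number x)"
    by (auto simp: limit_number_def successor_number_def limit_ordinal_iff_not_succ_ordinal)
  have explicit: "(limit_number x \<longrightarrow> l = birthday x) \<and>
      (successor_number x \<longrightarrow> l = ord_succ (birthday x)) \<and>
      (\<forall>c<l. f c = truncation x c \<and> truncation x c = {d \<in> x. d < c} \<union> {c})"
    if "proper_path_from_zero l f x" for l f
  proof -
    have l: "l = ?l" and f: "f = restrict (truncation x) {..<l}"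
      using that unfolding proper by (rule conjunct1, rule conjunct2)
    have "c \<le> birthday x" if "c < l" for c
      using that unfolding l by (simp add: less_ord_succ_iff split: if_splits)
    moreover have "f c = truncation x c" if "c < l" for c
      using that by (subst f) simp
    ultimately show ?thesis
      using l exclusive truncation_eq[OF assms] by presburger
  qed
  show ?thesis
    by (intro conjI[OF unique] conjI[OF allI[OF allI[OF impI]]] allI)
      (rule explicit, assumption, rule paths)
qed

end
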